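(* Let $p$ be a prime number such that $p=a^2+8$ for some integer $a$, and such that $\omega(p-x^2)\leq 2$ for every odd integer $x$ with $x^2<p$. Then $p\in\{17,89,233,1097\}$.
   Context: For a positive integer $n$, $\omega(n)$ denotes the number of distinct prime divisors of $n$: if $n=p_1^{a_1}\cdots p_r^{a_r}$ with $p_j$ distinct primes and $a_j$ positive integers, then $\omega(n)=r$; by convention $\omega(1)=0$. *)

theory Defs
  imports "HOL-Number_Theory.Number_Theory"
begin

text \<open>The number of distinct prime divisors of a positive integer.\<close>

definition omega :: "nat \<Rightarrow> nat" where
  "omega n = card (prime_factors n)"

end

theory Submission
  imports Defs
begin

text \<open>For \<open>x = 3\<close> we have \<open>p - x\<^sup>2 = (a - 1)(a + 1)\<close>, so one of \<open>a - 1\<close>, \<open>a + 1\<close> is a power of 2, that is,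
  \<open>a = 2\<^sup>m \<plusminus> 1\<close>. On the other hand, an odd prime \<open>r\<close> modulo which \<open>p\<close> is a nonzero square forces
  \<open>p < 82 r\<^sup>4\<close>. As \<open>3\<close> divides \<open>a\<close>, the parity of \<open>m\<close> is known, and the residue of \<open>m\<close> then provides
  a suitable \<open>r \<in> {7, 11, 31, 331}\<close> (for \<open>a = 2\<^sup>m - 1\<close>) or \<open>r \<in> {5, 17}\<close> (for \<open>a = 2\<^sup>m + 1\<close>), except that
  \<open>17\<close> divides \<open>p\<close> when \<open>a = 2\<^sup>m + 1\<close> and \<open>m \<equiv> 1 (mod 8)\<close>. So \<open>m\<close> is small.\<close>

section \<open>Even numbers with at most two prime divisors\<close>

lemma omega_le_2_odd_prime_unique:
  fixes n q r :: nat
  assumes "omega n \<le> 2" "n > 0" "even n"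
    and "prime q" "q dvd n" "odd q" "prime r" "r dvd n" "odd r"
  shows "q = r"
proof (rule ccontr)
  assume "q \<noteq> r"
  moreover have "q \<noteq> 2" "r \<noteq> 2" using assms by auto
  ultimately have "card {2, q, r} = 3" by auto
  moreover have "{2, q, r} \<subseteq> prime_factors n"
    using assms by (auto simp: in_prime_factors_iff)
  hence "card {2, q, r} \<le> omega n"
    unfolding omega_def by (intro card_mono) auto
  ultimately show False using assms(1) by simp
qed

text \<open>The primes 2 and \<open>r\<close> already exhaust the two allowed prime
  divisors.\<close>

lemma omega_le_2_imp_two_powers:
  fixes n r :: nat
  assumes "omega n \<le> 2" "n > 0" "even n" "prime r" "r dvd n" "odd r"
  obtains s t where "n = 2 ^ s * r ^ t"
proof -
  have sub: "prime_factors n = {2, r}"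
  proof
    show "prime_factors n \<subseteq> {2, r}"
    proof
      fix q assume "q \<in> prime_factors n"
      hence q: "prime q" "q dvd n" by (auto simp: in_prime_factors_iff)
      show "q \<in> {2, r}"
      proof (cases "odd q")
        case True
        thus ?thesis using omega_le_2_odd_prime_unique[OF assms(1-3) q] assms by blast
      next
        case False
        thus ?thesis using q by (metis insertI1 primes_dvd_imp_eq two_is_prime_nat)
      qed
    qed
  next
    show "{2, r} \<subseteq> prime_factors n"
      using assms by (auto simp: in_prime_factors_iff)
  qed
  have "r \<noteq> 2" using assms by auto
  have "n = (\<Prod>q\<in>prime_factors n. q ^ multiplicity q n)"
    using prod_prime_factors[of n] assms by simp
  also have "\<dots> = 2 ^ multiplicity 2 n * r ^ multiplicity r n"
    using \<open>r \<noteq> 2\<close> by (simp add: sub)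
  finally show ?thesis by (rule that)
qed

lemma no_odd_prime_factor_imp_power_2:
  fixes n :: nat
  assumes "n > 0" "\<And>q. prime q \<Longrightarrow> odd q \<Longrightarrow> \<not> q dvd n"
  obtains m where "n = 2 ^ m"
proof -
  obtain k where k: "n = 2 ^ multiplicity 2 n * k" "\<not> 2 dvd k"
    using multiplicity_decompose'[of n 2] assms(1) by auto
  have "k = 1"
  proof (rule ccontr)
    assume "k \<noteq> 1"
    then obtain q where "prime q" "q dvd k" using prime_factor_nat by blast
    moreover have "odd q" using \<open>q dvd k\<close> k(2) dvd_trans by blast
    ultimately show False using assms(2) k(1) by (metis dvd_mult)
  qed
  with k(1) show ?thesis using that by simp
qed

section \<open>Bounding \<open>p\<close> by an odd prime modulo which it is a square\<close>

text \<open>The smaller of the two powers divides both \<open>u\<close> and \<open>v\<close>, hence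
  also their nonzero difference, which is less than \<open>D\<close> in absolute value.\<close>

lemma power_dvd_close_values:
  fixes u v q D :: int
  assumes "q ^ i dvd u" "q ^ j dvd v" "u \<noteq> v" "\<bar>u - v\<bar> < D"
  shows "q ^ i < D \<or> q ^ j < D"
proof -
  have *: "q ^ k < D" if "q ^ k dvd u - v" for k
    using dvd_imp_le_int[OF _ that] assms(3,4) by auto
  show ?thesis
  proof (cases "i \<le> j")
    case True
    hence "q ^ i dvd q ^ j" by (rule le_imp_power_dvd)
    hence "q ^ i dvd v" using assms(2) by (rule dvd_trans)
    thus ?thesis using * assms(1) by (meson dvd_diff)
  next
    case False
    hence "q ^ j dvd q ^ i" by (intro le_imp_power_dvd) simp
    hence "q ^ j dvd u" using assms(1) by (rule dvd_trans)
    thus ?thesis using * assms(2) by (meson dvd_diff)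
  qed
qed

text \<open>Along a residue class modulo \<open>2r\<close> all values \<open>p - x\<^sup>2\<close> have the form \<open>2\<^sup>s r\<^sup>t\<close>. Among three of
  them that are close together, at most one has a large factor \<open>2\<^sup>s\<close> and at most one a large factor
  \<open>r\<^sup>t\<close>, so the third is small altogether.\<close>

lemma split_prime_bound:
  fixes p r y :: int
  assumes omega: "\<And>x :: int. odd x \<Longrightarrow> x\<^sup>2 < p \<Longrightarrow> omega (nat (p - x\<^sup>2)) \<le> 2"
    and "odd p" "prime r" "odd r" "[y\<^sup>2 = p] (mod r)" "\<not> r dvd p"
  shows "p < 82 * r ^ 4"
proof -
  have r: "r \<ge> 3"
    using prime_ge_2_int[OF \<open>prime r\<close>] \<open>odd r\<close> by (cases "r = 2") auto
  \<comment> \<open>Used at the end to absorb \<open>x^2 < 9 r^2\<close> into one more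
    \<open>r^4\<close>, which turns 81 into 82.\<close>
  have r4: "9 * r\<^sup>2 \<le> r ^ 4"
  proof -
    have "3\<^sup>2 \<le> r\<^sup>2" using r by (intro power_mono) auto
    hence "9 * r\<^sup>2 \<le> r\<^sup>2 * r\<^sup>2" by (intro mult_right_mono) auto
    thus ?thesis by (simp flip: power_add)
  qed
  show ?thesis
  proof (cases "9 * r\<^sup>2 \<le> p")
    case False
    moreover have "r ^ 4 > 0" using r by simp
    ultimately show ?thesis using r4 by linarith
  next
    \<comment> \<open>Now every \<open>x\<close> with \<open>0 < x < 3 r\<close> satisfies
      \<open>x^2 < p\<close>, so the hypothesis on \<open>omega\<close> applies to each odd
      one.\<close>
    case True
    define y0 where "y0 = y mod r"
    have "[y0\<^sup>2 = p] (mod r)"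
      using assms(5) unfolding y0_def cong_def by (simp add: power_mod)
    hence y0: "r dvd p - y0\<^sup>2" by (metis cong_iff_dvd_diff cong_sym)
    have "y0 \<noteq> 0" using y0 assms(6) by auto
    hence y0r: "0 < y0" "y0 < r"
      using r pos_mod_sign[of r y] pos_mod_bound[of r y] unfolding y0_def by linarith+
    \<comment> \<open>Both \<open>y0\<close> and \<open>r - y0\<close> are square roots of
      \<open>p\<close> modulo \<open>r\<close>; as \<open>r\<close> is odd, exactly one of them is
      odd.\<close>
    define z where "z = (if odd y0 then y0 else r - y0)"
    have z: "odd z" "0 < z" "z < r" using y0r \<open>odd r\<close> by (auto simp: z_def)
    have zr: "r dvd p - z\<^sup>2"
    proof (cases "odd y0")
      case False
      have "p - (r - y0)\<^sup>2 = (p - y0\<^sup>2) + r * (2 * y0 - r)"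
        by (simp add: power2_eq_square algebra_simps)
      hence "r dvd p - (r - y0)\<^sup>2" using y0 by (metis dvd_add dvd_triv_left)
      thus ?thesis using False by (simp add: z_def)
    qed (use y0 in \<open>simp add: z_def\<close>)
    have form: "\<exists>s t. p - x\<^sup>2 = 2 ^ s * r ^ t" if x: "odd x" "0 < x" "x < 3 * r" "r dvd p - x\<^sup>2" for x
    proof -
      have lt: "x\<^sup>2 < p"
      proof -
        have "x\<^sup>2 < (3 * r)\<^sup>2" using x by (intro power_strict_mono) auto
        thus ?thesis using True by (simp add: power_mult_distrib)
      qed
      let ?n = "nat (p - x\<^sup>2)"
      have "even (p - x\<^sup>2)" using x \<open>odd p\<close> by simp
      hence ev: "even ?n" using lt by (simp add: even_nat_iff)
      have "nat r dvd ?n" using x(4) lt r by (simp add: nat_dvd_iff)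
      moreover have "odd (nat r)" using \<open>odd r\<close> r by (simp add: even_nat_iff)
      moreover have "prime (nat r)" using \<open>prime r\<close> by simp
      ultimately obtain s t where "?n = 2 ^ s * nat r ^ t"
        using omega_le_2_imp_two_powers[of ?n "nat r"] omega[OF x(1) lt] lt ev by auto
      hence "int ?n = 2 ^ s * r ^ t" using r by simp
      thus ?thesis using lt by auto
    qed
    have sq: "(3 * r)\<^sup>2 = 9 * r\<^sup>2" by (simp add: power_mult_distrib)
    have dist: "\<bar>(p - x\<^sup>2) - (p - w\<^sup>2)\<bar> < 9 * r\<^sup>2" "p - x\<^sup>2 \<noteq> p - w\<^sup>2"
      if "0 < x" "x < 3 * r" "0 < w" "w < 3 * r" "x \<noteq> w" for x w
    proof -
      have "x\<^sup>2 < (3 * r)\<^sup>2" "w\<^sup>2 < (3 * r)\<^sup>2"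
        by (rule power_strict_mono; use that in simp)+
      moreover have "x\<^sup>2 \<ge> 0" "w\<^sup>2 \<ge> 0" by auto
      ultimately show "\<bar>(p - x\<^sup>2) - (p - w\<^sup>2)\<bar> < 9 * r\<^sup>2"
        unfolding sq by linarith
      show "p - x\<^sup>2 \<noteq> p - w\<^sup>2" using that by (auto simp: power2_eq_iff)
    qed
    have alt: "q ^ i < 9 * r\<^sup>2 \<or> q ^ j < 9 * r\<^sup>2"
      if "q ^ i dvd p - x\<^sup>2" "q ^ j dvd p - w\<^sup>2"
        "0 < x" "x < 3 * r" "0 < w" "w < 3 * r" "x \<noteq> w" for q x w i j
      by (rule power_dvd_close_values[OF that(1,2) dist(2,1)]) (use that in auto)
    \<comment> \<open>With \<open>z\<close> these are three distinct odd numbers below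
      \<open>3 r\<close>, all congruent to \<open>z\<close> or \<open>-z\<close> modulo
      \<open>r\<close>.\<close>
    define x2 x3 where "x2 = 2 * r - z" and "x3 = 2 * r + z"
    have d2: "r dvd p - x2\<^sup>2"
    proof -
      have "p - x2\<^sup>2 = (p - z\<^sup>2) + r * (4 * z - 4 * r)"
        by (simp add: x2_def power2_eq_square algebra_simps)
      thus ?thesis using zr by (metis dvd_add dvd_triv_left)
    qed
    have d3: "r dvd p - x3\<^sup>2"
    proof -
      have "p - x3\<^sup>2 = (p - z\<^sup>2) + r * (- 4 * z - 4 * r)"
        by (simp add: x3_def power2_eq_square algebra_simps)
      thus ?thesis using zr by (metis dvd_add dvd_triv_left)
    qed
    have x2: "odd x2" "0 < x2" "x2 < 3 * r" and x3: "odd x3" "0 < x3" "x3 < 3 * r"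
      and ne: "z \<noteq> x2" "z \<noteq> x3" "x2 \<noteq> x3" and z3: "z < 3 * r"
      using z r by (auto simp: x2_def x3_def)
    obtain s1 t1 where 1: "p - z\<^sup>2 = 2 ^ s1 * r ^ t1" using form[of z] z z3 zr by blast
    obtain s2 t2 where 2: "p - x2\<^sup>2 = 2 ^ s2 * r ^ t2" using form[of x2] x2 d2 by blast
    obtain s3 t3 where 3: "p - x3\<^sup>2 = 2 ^ s3 * r ^ t3" using form[of x3] x3 d3 by blast
    \<comment> \<open>Comparing all pairs: at most one power of 2 and at most one power of
      \<open>r\<close> reach \<open>9 r^2\<close>, so one of the three indices has both powers
      small.\<close>
    have "2 ^ s1 < 9 * r\<^sup>2 \<or> 2 ^ s2 < 9 * r\<^sup>2" "r ^ t1 < 9 * r\<^sup>2 \<or> r ^ t2 < 9 * r\<^sup>2"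
      by (rule alt[of _ _ z _ x2]; use 1 2 z z3 x2 ne in simp)+
    moreover have "2 ^ s1 < 9 * r\<^sup>2 \<or> 2 ^ s3 < 9 * r\<^sup>2" "r ^ t1 < 9 * r\<^sup>2 \<or> r ^ t3 < 9 * r\<^sup>2"
      by (rule alt[of _ _ z _ x3]; use 1 3 z z3 x3 ne in simp)+
    moreover have "2 ^ s2 < 9 * r\<^sup>2 \<or> 2 ^ s3 < 9 * r\<^sup>2" "r ^ t2 < 9 * r\<^sup>2 \<or> r ^ t3 < 9 * r\<^sup>2"
      by (rule alt[of _ _ x2 _ x3]; use 2 3 x2 x3 ne in simp)+
    ultimately obtain x s t where x: "p - x\<^sup>2 = 2 ^ s * r ^ t" "0 < x" "x < 3 * r"
      and st: "2 ^ s < 9 * r\<^sup>2" "r ^ t < 9 * r\<^sup>2"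
      using 1 2 3 z(2) z3 x2(2,3) x3(2,3) by metis
    have "2 ^ s * r ^ t < (9 * r\<^sup>2) * (9 * r\<^sup>2)"
      using st r by (intro mult_strict_mono) auto
    also have "\<dots> = 81 * r ^ 4" by (simp add: power2_eq_square power4_eq_xxxx)
    finally have "p < 81 * r ^ 4 + x\<^sup>2" using x(1) by linarith
    moreover have "x\<^sup>2 < (3 * r)\<^sup>2" using x by (intro power_strict_mono) auto
    ultimately show ?thesis using r4 by (simp add: power_mult_distrib)
  qed
qed

section \<open>Bounding the exponent through its residue class\<close>

lemma power_cong_mod_exponent:
  fixes r :: int
  assumes "[b ^ d = 1] (mod r)"
  shows "[b ^ m = b ^ (m mod d)] (mod r)"
proof -
  have "b ^ m = (b ^ d) ^ (m div d) * b ^ (m mod d)"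
    by (simp flip: power_mult power_add)
  moreover have "[(b ^ d) ^ (m div d) * b ^ (m mod d) = 1 ^ (m div d) * b ^ (m mod d)] (mod r)"
    by (intro cong_mult cong_pow assms cong_refl)
  ultimately show ?thesis by simp
qed

text \<open>Reduces the bound on \<open>p\<close> to a numerical check. Since \<open>d\<close> is a
  period of 2 modulo \<open>r\<close>, the residue \<open>m mod d\<close> determines
  \<open>p\<close> modulo \<open>r\<close>; \<open>y\<close> is an explicit square root of it, and
  from exponent \<open>k\<close> on \<open>p\<close> would exceed \<open>82 r^4\<close>. The cases
  \<open>e = -1\<close> and \<open>e = 1\<close> are the ones needed.\<close>

lemma exponent_bound:
  fixes p e r y :: int
  assumes omega: "\<And>x :: int. odd x \<Longrightarrow> x\<^sup>2 < p \<Longrightarrow> omega (nat (p - x\<^sup>2)) \<le> 2"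
    and "odd p" and p: "p = (2 ^ m + e)\<^sup>2 + 8" and e: "- 1 \<le> e"
    and "prime r" "odd r" and d: "2 ^ d mod r = 1"
    and y: "((2 ^ (m mod d) + e)\<^sup>2 + 8) mod r = y\<^sup>2 mod r" "y\<^sup>2 mod r \<noteq> 0"
    and k: "82 * r ^ 4 \<le> (2 ^ k - 1)\<^sup>2"
  shows "m < k"
proof (rule ccontr)
  assume "\<not> m < k"
  have "r > 1" using \<open>prime r\<close> by (rule prime_gt_1_int)
  hence "[2 ^ d = 1] (mod r)" using d by (simp add: cong_def)
  hence "[(2 ^ m + e)\<^sup>2 + 8 = (2 ^ (m mod d) + e)\<^sup>2 + 8] (mod r)"
    by (intro cong_add cong_pow power_cong_mod_exponent cong_refl)
  hence c: "[y\<^sup>2 = p] (mod r)" using y(1) by (simp add: p cong_def)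
  hence "\<not> r dvd p" using y(2) by (simp add: cong_def dvd_eq_mod_eq_0)
  hence "p < 82 * r ^ 4"
    using split_prime_bound[OF omega \<open>odd p\<close> \<open>prime r\<close> \<open>odd r\<close> c] by simp
  moreover have "(2 ^ k - 1)\<^sup>2 \<le> (2 ^ m + e)\<^sup>2"
  proof (rule power_mono)
    have "(2::int) ^ k \<le> 2 ^ m" using \<open>\<not> m < k\<close> by (intro power_increasing) auto
    thus "2 ^ k - 1 \<le> 2 ^ m + e" using e by linarith
  qed simp
  ultimately show False using k p by linarith
qed

section \<open>The value at \<open>x = 3\<close>\<close>

lemma odd_prime_pair_unique:
  fixes p x q r :: int
  assumes omega: "\<And>x :: int. odd x \<Longrightarrow> x\<^sup>2 < p \<Longrightarrow> omega (nat (p - x\<^sup>2)) \<le> 2"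
    and "odd p" "odd x" "x\<^sup>2 < p"
    and "prime q" "odd q" "q dvd p - x\<^sup>2" "prime r" "odd r" "r dvd p - x\<^sup>2"
  shows "q = r"
proof -
  have pos: "q > 0" "r > 0" using assms by (auto intro: prime_gt_0_int)
  have "even (p - x\<^sup>2)" using assms by simp
  hence "even (nat (p - x\<^sup>2))" using assms(4) by (simp add: even_nat_iff)
  hence "nat q = nat r"
    using omega[OF assms(3,4)] assms(4-) pos
    by (intro omega_le_2_odd_prime_unique[of "nat (p - x\<^sup>2)"])
       (auto simp: nat_dvd_iff even_nat_iff)
  thus ?thesis using pos by simp
qed

text \<open>An odd prime dividing both \<open>a - 1\<close> and \<open>a + 1\<close> would divide 2.
  So if each had an odd prime factor, these would be two different odd primes dividing the even
  number \<open>p - 9\<close>.\<close>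

lemma near_power_of_2:
  fixes p a :: int
  assumes omega: "\<And>x :: int. odd x \<Longrightarrow> x\<^sup>2 < p \<Longrightarrow> omega (nat (p - x\<^sup>2)) \<le> 2"
    and "odd p" and p: "p = a\<^sup>2 + 8" and a: "a > 1"
  obtains m where "a = 2 ^ m - 1" | m where "a = 2 ^ m + 1"
proof (cases "\<exists>q. prime q \<and> odd q \<and> q dvd nat (a + 1)")
  case False
  obtain m where "nat (a + 1) = 2 ^ m"
    by (rule no_odd_prime_factor_imp_power_2[of "nat (a + 1)"]) (use False a in auto)
  hence "int (nat (a + 1)) = 2 ^ m" by simp
  thus ?thesis using that(1)[of m] a by simp
next
  case True
  then obtain q where q: "prime q" "odd q" "q dvd nat (a + 1)" by blast
  have "\<not> r dvd nat (a - 1)" if r: "prime r" "odd r" for r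
  proof
    assume "r dvd nat (a - 1)"
    hence ra: "int r dvd a - 1" using a by (simp add: int_dvd_int_iff [symmetric])
    have qa: "int q dvd a + 1" using q(3) a by (simp add: int_dvd_int_iff [symmetric])
    have "p - 3\<^sup>2 = (a + 1) * (a - 1)"
      by (simp add: p power2_eq_square algebra_simps)
    hence dvd: "int q dvd p - 3\<^sup>2" "int r dvd p - 3\<^sup>2"
      using qa ra by (metis dvd_mult2, metis dvd_mult)
    have "1\<^sup>2 < a\<^sup>2" using a by (intro power_strict_mono) auto
    hence "3\<^sup>2 < p" by (simp add: p)
    hence "int q = int r"
      using q r dvd by (intro odd_prime_pair_unique[OF omega \<open>odd p\<close>, of 3]) auto
    hence "int q dvd (a + 1) - (a - 1)" using qa ra dvd_diff by metis
    hence "q dvd 2" by (simp flip: int_dvd_int_iff)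
    thus False using q(1,2) by (metis primes_dvd_imp_eq two_is_prime_nat dvd_refl)
  qed
  then obtain m where "nat (a - 1) = 2 ^ m"
    by (rule no_odd_prime_factor_imp_power_2[of "nat (a - 1)", rotated]) (use a in auto)
  hence "int (nat (a - 1)) = 2 ^ m" by simp
  thus ?thesis using that(2)[of m] a by simp
qed

section \<open>Case analysis on the exponent\<close>

lemma mod_eq_imp_eq:
  fixes m d c :: nat
  assumes "m mod d = c" "m < d + c"
  shows "m = c"
proof -
  have "d * (m div d) + c = m" using mult_div_mod_eq[of d m] assms(1) by simp
  hence "d * (m div d) < d * 1" using assms(2) by linarith
  hence "m div d = 0" by (simp only: mult_less_cancel1 less_one)
  thus ?thesis using \<open>d * (m div d) + c = m\<close> by simp
qed

theorem theorem1p3: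
  fixes p :: int
  assumes "prime p"
    and "\<exists>a :: int. p = a\<^sup>2 + 8"
    and "\<And>x :: int. odd x \<Longrightarrow> x\<^sup>2 < p \<Longrightarrow> omega (nat (p - x\<^sup>2)) \<le> 2"
  shows "p \<in> {17, 89, 233, 1097}"
proof -
  obtain a0 where a0: "p = a0\<^sup>2 + 8" using assms(2) by blast
  define a where "a = \<bar>a0\<bar>"
  have p: "p = a\<^sup>2 + 8" and a: "a \<ge> 0" using a0 by (auto simp: a_def)
  have p8: "p \<ge> 8" using p by simp
  have not_dvd: "\<not> q dvd p" if "prime q" "q < 8" for q :: int
    using primes_dvd_imp_eq[OF that(1) assms(1)] that(2) p8 by auto
  have "odd p" using not_dvd[of 2] by simp
  have a1: "a > 1"
  proof (rule ccontr)
    assume "\<not> a > 1"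
    hence "a = 0 \<or> a = 1" using a by auto
    thus False using not_dvd[of 2] not_dvd[of 3] p by auto
  qed
  \<comment> \<open>Otherwise \<open>a^2\<close> is 1 modulo 3 and 3 divides
    \<open>p\<close>.\<close>
  have "a mod 3 = 0"
  proof (rule ccontr)
    assume "a mod 3 \<noteq> 0"
    hence "a mod 3 = 1 \<or> a mod 3 = 2" by presburger
    hence "(a mod 3)\<^sup>2 mod 3 = 1" by auto
    hence "a\<^sup>2 mod 3 = 1" by (simp add: power_mod)
    hence "p mod 3 = 0" unfolding p by presburger
    thus False using not_dvd[of 3] by (simp add: dvd_eq_mod_eq_0)
  qed
  have bound: "m < k"
    if "p = (2 ^ m + e)\<^sup>2 + 8" "- 1 \<le> e" "prime r" "odd r" "2 ^ d mod r = 1"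
      "((2 ^ (m mod d) + e)\<^sup>2 + 8) mod r = y\<^sup>2 mod r" "y\<^sup>2 mod r \<noteq> 0"
      "82 * r ^ 4 \<le> (2 ^ k - 1)\<^sup>2" for m k d :: nat and e r y :: int
    by (rule exponent_bound[OF assms(3) \<open>odd p\<close> that])
  have mod3: "(2 :: int) ^ m mod 3 = 2 ^ (m mod 2) mod 3" for m
    using power_cong_mod_exponent[of 2 2 3 m] by (simp add: cong_def)
  from assms(3) \<open>odd p\<close> p a1 show ?thesis
  proof (rule near_power_of_2)
    fix m assume am: "a = 2 ^ m - 1"
    hence pm: "p = (2 ^ m + (- 1))\<^sup>2 + 8" using p by simp
    have "even m"
    proof (rule ccontr)
      assume "odd m"
      hence "(2 :: int) ^ m mod 3 = 2" using mod3[of m] by (simp add: odd_iff_mod_2_eq_one)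
      thus False using \<open>a mod 3 = 0\<close> am by presburger
    qed
    \<comment> \<open>Here \<open>a = 63\<close> and \<open>p = 41 * 97\<close>.\<close>
    have not6: "m \<noteq> 6"
    proof
      assume "m = 6"
      hence "p = 3977" by (simp add: pm)
      moreover from this have "41 dvd p" by simp
      hence "41 = p" by (intro primes_dvd_imp_eq assms(1)) auto
      ultimately show False by simp
    qed
    \<comment> \<open>Here \<open>p = 65033\<close> and
      \<open>p - 131^2 = 2^8 * 11 * 17\<close>.\<close>
    have not8: "m \<noteq> 8"
    proof
      assume "m = 8"
      thus False
        using odd_prime_pair_unique[OF assms(3) \<open>odd p\<close>, of 131 11 17] by (simp add: pm)
    qed
    have m0: "m \<noteq> 0" using am a1 by (cases m) auto
    \<comment> \<open>In the remaining class \<open>m mod 3 = 2\<close>, \<open>p\<close> is 3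
      modulo 7, a non-square.\<close>
    have r7: "m < 9" if "m mod 3 = 0 \<or> m mod 3 = 1"
      using that
    proof
      assume "m mod 3 = 0"
      thus ?thesis by (intro bound[OF pm, of 7 3 1]) auto
    next
      assume "m mod 3 = 1"
      thus ?thesis by (intro bound[OF pm, of 7 3 3]) auto
    qed
    have r31: "m < 14" if "m mod 5 = 0 \<or> m mod 5 = 1 \<or> m mod 5 = 4"
      using that
    proof (elim disjE)
      assume "m mod 5 = 0"
      thus ?thesis by (intro bound[OF pm, of 31 5 15]) auto
    next
      assume "m mod 5 = 1"
      thus ?thesis by (intro bound[OF pm, of 31 5 3]) auto
    next
      assume "m mod 5 = 4"
      thus ?thesis by (intro bound[OF pm, of 31 5 4]) auto
    qed
    have r11: "m < 11" if "m mod 10 = 8"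
      using that by (intro bound[OF pm, of 11 10 1]) auto
    \<comment> \<open>The prime 331 divides \<open>2^30 - 1\<close>, and \<open>103^2\<close> is 17
      modulo 331. The class contains the genuine solution \<open>m = 2\<close>, where
      \<open>p = 17\<close>.\<close>
    have r331: "m < 20" if "m mod 30 = 2"
      using that by (intro bound[OF pm, of 331 30 103]) auto
    have "m = 2 \<or> m = 4"
    proof (cases "m mod 3 = 2")
      case False
      hence "m mod 3 = 0 \<or> m mod 3 = 1" by presburger
      with r7 have "m < 9" by blast
      hence "m \<in> {0,1,2,3,4,5,6,7,8}" by auto
      thus ?thesis using not6 not8 m0 \<open>even m\<close> by auto
    next
      case True
      consider "m mod 5 = 0 \<or> m mod 5 = 1 \<or> m mod 5 = 4" | "m mod 5 = 3" | "m mod 5 = 2"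
        by linarith
      thus ?thesis
      proof cases
        case 1
        hence "m < 14" by (rule r31)
        \<comment> \<open>Modulus 12 is large enough for \<open>m < 14\<close> to leave only 2 and
          8.\<close>
        moreover have "m mod 12 = 2 \<or> m mod 12 = 8" using True \<open>even m\<close> by presburger
        ultimately have "m = 2 \<or> m = 8" using mod_eq_imp_eq[of m 12] by auto
        thus ?thesis using not8 by blast
      next
        case 2
        hence "m mod 10 = 8" using \<open>even m\<close> by presburger
        with r11 have "m < 11" by blast
        hence "m = 8" using \<open>m mod 10 = 8\<close> mod_eq_imp_eq[of m 10 8] by simp
        thus ?thesis using not8 by blast
      next
        case 3
        hence "[m = 2] (mod 5)" by (simp add: cong_def)
        moreover have "m mod 6 = 2" using True \<open>even m\<close> by presburger
        hence "[m = 2] (mod 6)" by (simp add: cong_def)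
        moreover have "coprime 5 (6 :: nat)" by (simp add: coprime_iff_gcd_eq_1 gcd_non_0_nat)
        ultimately have "[m = 2] (mod 5 * 6)" by (rule coprime_cong_mult_nat)
        hence "m mod 30 = 2" by (simp add: cong_def)
        with r331 have "m < 20" by blast
        thus ?thesis using \<open>m mod 30 = 2\<close> mod_eq_imp_eq[of m 30 2] by simp
      qed
    qed
    thus ?thesis by (auto simp: pm)
  next
    fix m assume am: "a = 2 ^ m + 1"
    hence pm: "p = (2 ^ m + 1)\<^sup>2 + 8" using p by simp
    have "odd m"
    proof (rule ccontr)
      assume "\<not> odd m"
      hence "(2 :: int) ^ m mod 3 = 1" using mod3[of m] by (simp add: even_iff_mod_2_eq_zero)
      thus False using \<open>a mod 3 = 0\<close> am by presburger
    qed
    \<comment> \<open>Here \<open>p = 16649\<close> and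
      \<open>p - 3^2 = 2^8 * 5 * 13\<close>.\<close>
    have not7: "m \<noteq> 7"
    proof
      assume "m = 7"
      thus False
        using odd_prime_pair_unique[OF assms(3) \<open>odd p\<close>, of 3 5 13] by (simp add: pm)
    qed
    have r5: "m < 8" if "m mod 4 = 3"
      using that by (intro bound[OF pm, of 5 4 2]) auto
    have r17: "m < 12" if "m mod 8 = 5"
      using that by (intro bound[OF pm, of 17 8 3]) auto
    have "m mod 4 = 3 \<or> m mod 8 = 5 \<or> m mod 8 = 1"
      using \<open>odd m\<close> by presburger
    then consider "m mod 4 = 3" | "m mod 8 = 5" | "m mod 8 = 1" by blast
    thus ?thesis
    proof cases
      case 1
      with r5 have "m < 8" by blast
      moreover have "m mod 8 = 3 \<or> m mod 8 = 7" using 1 by presburger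
      ultimately have "m = 3" using not7 mod_eq_imp_eq[of m 8] by auto
      thus ?thesis by (simp add: pm)
    next
      case 2
      with r17 have "m < 12" by blast
      hence "m = 5" using 2 mod_eq_imp_eq[of m 8 5] by simp
      thus ?thesis by (simp add: pm)
    next
      case 3
      \<comment> \<open>No bound on \<open>m\<close> is available here; instead \<open>p\<close> is
        \<open>3^2 + 8 = 17\<close>, that is 0, modulo 17, and primality gives
        \<open>p = 17\<close>.\<close>
      have "[2 ^ m = 2 ^ (m mod 8)] (mod (17 :: int))"
        by (rule power_cong_mod_exponent) (simp add: cong_def)
      hence "[2 ^ m = 2] (mod (17 :: int))" using 3 by simp
      hence "[p = (2 + 1)\<^sup>2 + 8] (mod 17)"
        unfolding pm by (intro cong_add cong_pow cong_refl)
      hence "17 dvd p" by (simp add: cong_def dvd_eq_mod_eq_0)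
      hence "p = 17" using primes_dvd_imp_eq[of 17 p] assms(1) by simp
      thus ?thesis by simp
    qed
  qed
qed

end
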